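(* Consider the open XX chain of length $L\ge1$ with free-fermion Hamiltonian $H=-\frac12\sum_{j=1}^{L-1}(c_j^\dagger c_{j+1}+c_{j+1}^\dagger c_j)$, and let $|\psi\rangle$ be the ground state at a given filling $N\in\{0,1,\dots,L\}$, i.e. the normalized Slater determinant in which the $N$ lowest single-particle energy levels are occupied, so that $|\psi\rangle$ has definite total particle number $N$. Let $A\subset\{1,\dots,L\}$ be a contiguous block of $\ell$ sites, $B$ its complement, and $\rho_A=\mathrm{Tr}_B|\psi\rangle\langle\psi|$. Then $[\rho_A,Q_A]=0$, where $Q_A=\sum_{j\in A}c_j^\dagger c_j$, and the Rényi-$\alpha$ $U(1)$ entanglement asymmetry vanishes exactly: $$\mathcal{E}_\alpha(\rho_A)=S_\alpha(\Delta(\rho_A))-S_\alpha(\rho_A)=0$$ for every $\alpha>0$, every block length $\ell$, and every filling.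
   Context: The $c_j,c_j^\dagger$ ($1\le j\le L$) are fermionic annihilation and creation operators with canonical anticommutation relations, obtained from the spin-$\frac12$ XX chain by the Jordan–Wigner transformation. The single-particle modes are $\psi_n(j)\propto\sin(nj\pi/(L+1))$, $n=1,\dots,L$; filling the modes up to the Fermi momentum $k_F$ corresponds to a choice of $N$. $Q_A$ is the particle number in $A$, $Q_B$ the particle number in $B$, and the total number is $Q_A+Q_B$. For each eigenvalue $q$ of $Q_A$, $\Pi_q$ is the orthogonal projection onto the corresponding eigenspace, and $\Delta(\rho_A)=\sum_q\Pi_q\rho_A\Pi_q$ is the $U(1)$ dephasing map. The Rényi entropy of a density matrix $\rho$ is $S_\alpha(\rho)=\frac{1}{1-\alpha}\ln\mathrm{Tr}(\rho^\alpha)$ for $\alpha>0$, $\alpha\ne1$, and $S_1(\rho)=-\mathrm{Tr}(\rho\ln\rho)$. *)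

theory Defs
  imports "Jordan_Normal_Form.Spectral_Radius"
begin

section \<open>Matrices\<close>

definition trace :: "complex mat \<Rightarrow> complex" where
  "trace M = (\<Sum>i<dim_row M. M $$ (i, i))"

text \<open>Matrices of different sizes share one type, so \<^const>\<open>sum\<close> is not available on them.\<close>

definition mat_sum :: "nat \<Rightarrow> ('i \<Rightarrow> complex mat) \<Rightarrow> 'i set \<Rightarrow> complex mat" where
  "mat_sum d F I = mat d d (\<lambda>(s, t). \<Sum>i\<in>I. F i $$ (s, t))"

definition eigenprojection :: "complex mat \<Rightarrow> complex \<Rightarrow> complex mat" where
  "eigenprojection M q = (THE P. P \<in> carrier_mat (dim_row M) (dim_row M) \<and>
     mat_adjoint P = P \<and> P * P = P \<and>
     (\<forall>v\<in>carrier_vec (dim_row M). P *\<^sub>v v = v \<longleftrightarrow> M *\<^sub>v v = q \<cdot>\<^sub>v v))"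

text \<open>Functional calculus \<open>f(M)\<close> of a Hermitian matrix; its eigenvalues are real.\<close>

definition mat_fun :: "(real \<Rightarrow> real) \<Rightarrow> complex mat \<Rightarrow> complex mat" where
  "mat_fun f M = mat_sum (dim_row M)
     (\<lambda>q. complex_of_real (f (Re q)) \<cdot>\<^sub>m eigenprojection M q) (spectrum M)"

section \<open>Entropy and asymmetry\<close>

text \<open>
  For a density matrix both traces are real. The conventions \<open>0 powr \<alpha> = 0\<close> and \<open>ln 0 = 0\<close>
  make zero eigenvalues contribute nothing.
\<close>

definition renyi_entropy :: "real \<Rightarrow> complex mat \<Rightarrow> real" where
  "renyi_entropy \<alpha> \<rho> =
     (if \<alpha> = 1 then - Re (trace (\<rho> * mat_fun ln \<rho>))
      else 1 / (1 - \<alpha>) * ln (Re (trace (mat_fun (\<lambda>x. x powr \<alpha>) \<rho>))))"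

definition dephasing :: "complex mat \<Rightarrow> complex mat \<Rightarrow> complex mat" where
  "dephasing Q \<rho> = mat_sum (dim_row \<rho>)
     (\<lambda>q. eigenprojection Q q * \<rho> * eigenprojection Q q) (spectrum Q)"

definition renyi_asymmetry :: "real \<Rightarrow> complex mat \<Rightarrow> complex mat \<Rightarrow> real" where
  "renyi_asymmetry \<alpha> Q \<rho> = renyi_entropy \<alpha> (dephasing Q \<rho>) - renyi_entropy \<alpha> \<rho>"

section \<open>Fermions on an open chain\<close>

text \<open>
  The Hilbert space of \<open>L\<close> spins is spanned by the basis vectors with indices \<open>s < 2 ^ L\<close>;
  site \<open>j\<close>, for \<open>1 \<le> j \<le> L\<close>, is occupied (spin up) in \<open>s\<close> iff \<open>bit s (j - 1)\<close>. The sign is the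
  Jordan-Wigner string over the sites to the left of \<open>j\<close>.
\<close>

definition annihilation :: "nat \<Rightarrow> nat \<Rightarrow> complex mat" where
  "annihilation L j = mat (2 ^ L) (2 ^ L) (\<lambda>(s, t).
     if bit t (j - 1) \<and> s = unset_bit (j - 1) t
     then (- 1) ^ card {i. i < j - 1 \<and> bit t i} else 0)"

definition creation :: "nat \<Rightarrow> nat \<Rightarrow> complex mat" where
  "creation L j = mat_adjoint (annihilation L j)"

definition particle_number :: "nat \<Rightarrow> nat set \<Rightarrow> complex mat" where
  "particle_number L S = mat_sum (2 ^ L) (\<lambda>j. creation L j * annihilation L j) S"

definition xx_hamiltonian :: "nat \<Rightarrow> complex mat" where
  "xx_hamiltonian L = (- 1 / 2) \<cdot>\<^sub>m mat_sum (2 ^ L)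
     (\<lambda>j. creation L j * annihilation L (j + 1) + creation L (j + 1) * annihilation L j) {1..<L}"

definition vacuum :: "nat \<Rightarrow> complex vec" where
  "vacuum L = unit_vec (2 ^ L) 0"

definition mode_creation :: "nat \<Rightarrow> (nat \<Rightarrow> complex) \<Rightarrow> complex mat" where
  "mode_creation L u = mat_sum (2 ^ L) (\<lambda>j. u j \<cdot>\<^sub>m creation L j) {1..L}"

text \<open>
  An orthonormal system of \<open>L\<close> single-particle eigenstates \<open>u 1, \<dots>, u L\<close>, with energy levels
  \<open>e 1 \<le> \<dots> \<le> e L\<close> (the vacuum has energy \<open>0\<close>).
\<close>

definition single_particle_modes ::
  "nat \<Rightarrow> (nat \<Rightarrow> nat \<Rightarrow> complex) \<Rightarrow> (nat \<Rightarrow> real) \<Rightarrow> bool" where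
  "single_particle_modes L u e \<longleftrightarrow>
     (\<forall>m\<in>{1..L}. \<forall>n\<in>{1..L}. (\<Sum>j=1..L. cnj (u m j) * u n j) = (if m = n then 1 else 0)) \<and>
     (\<forall>n\<in>{1..L}. xx_hamiltonian L *\<^sub>v (mode_creation L (u n) *\<^sub>v vacuum L) =
        complex_of_real (e n) \<cdot>\<^sub>v (mode_creation L (u n) *\<^sub>v vacuum L)) \<and>
     (\<forall>m\<in>{1..L}. \<forall>n\<in>{1..L}. m \<le> n \<longrightarrow> e m \<le> e n)"

fun slater :: "nat \<Rightarrow> (nat \<Rightarrow> nat \<Rightarrow> complex) \<Rightarrow> nat \<Rightarrow> complex vec" where
  "slater L u 0 = vacuum L"
| "slater L u (Suc n) = mode_creation L (u (Suc n)) *\<^sub>v slater L u n"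

text \<open>The ground state at filling \<open>N\<close>; it is determined up to a phase, which \<open>z\<close> accounts for.\<close>

definition is_ground_state :: "nat \<Rightarrow> nat \<Rightarrow> complex vec \<Rightarrow> bool" where
  "is_ground_state L N \<psi> \<longleftrightarrow> \<psi> \<bullet>c \<psi> = 1 \<and>
     (\<exists>u e z. single_particle_modes L u e \<and> \<psi> = z \<cdot>\<^sub>v slater L u N)"

section \<open>The block of sites \<open>a + 1, \<dots>, a + l\<close>\<close>

definition pure_density :: "complex vec \<Rightarrow> complex mat" where
  "pure_density \<psi> = mat (dim_vec \<psi>) (dim_vec \<psi>) (\<lambda>(s, t). \<psi> $ s * cnj (\<psi> $ t))"

text \<open>
  A basis index \<open>s < 2 ^ L\<close> is \<open>x + 2 ^ a * (i + 2 ^ l * y)\<close>, where \<open>x < 2 ^ a\<close>, \<open>i < 2 ^ l\<close> and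
  \<open>y < 2 ^ (L - a - l)\<close> are the configurations to the left of, inside and to the right of the
  block. The partial trace is the one of this tensor product of spin spaces.
\<close>

definition reduced_to_block :: "nat \<Rightarrow> nat \<Rightarrow> nat \<Rightarrow> complex mat \<Rightarrow> complex mat" where
  "reduced_to_block L a l R = mat (2 ^ l) (2 ^ l) (\<lambda>(i, k).
     \<Sum>x<2 ^ a. \<Sum>y<2 ^ (L - a - l).
       R $$ (x + 2 ^ a * (i + 2 ^ l * y), x + 2 ^ a * (k + 2 ^ l * y)))"

text \<open>\<open>1 \<otimes> X \<otimes> 1\<close> for an operator \<open>X\<close> on the block.\<close>

definition extend_from_block :: "nat \<Rightarrow> nat \<Rightarrow> nat \<Rightarrow> complex mat \<Rightarrow> complex mat" where
  "extend_from_block L a l X = mat (2 ^ L) (2 ^ L) (\<lambda>(s, t).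
     if s mod 2 ^ a = t mod 2 ^ a \<and> s div 2 ^ (a + l) = t div 2 ^ (a + l)
     then X $$ (s div 2 ^ a mod 2 ^ l, t div 2 ^ a mod 2 ^ l) else 0)"

text \<open>
  \<open>Q\<^sub>A\<close> as an operator on the Hilbert space of the block, which is that of a chain of \<open>l\<close> sites:
  the Jordan-Wigner strings outside the block cancel, as the lemma below shows.
\<close>

definition block_number :: "nat \<Rightarrow> complex mat" where
  "block_number l = particle_number l {1..l}"

lemma annihilation_carrier: "annihilation L j \<in> carrier_mat (2 ^ L) (2 ^ L)"
  by (simp add: annihilation_def)

lemma mat_adjoint_index:
  "i < dim_col M \<Longrightarrow> k < dim_row M \<Longrightarrow> mat_adjoint M $$ (i, k) = conjugate (M $$ (k, i))"
  unfolding mat_adjoint_def by (simp add: mat_of_rows_def)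

lemma number_index:
  assumes "s < 2 ^ L" "t < 2 ^ L"
  shows "(creation L j * annihilation L j) $$ (s, t) = (if s = t \<and> bit s (j - 1) then 1 else 0)"
proof -
  let ?n = "j - 1"
  let ?sg = "\<lambda>s. (- 1 :: complex) ^ card {i. i < ?n \<and> bit s i}"
  have dims: "dim_row (annihilation L j) = 2 ^ L" "dim_col (annihilation L j) = 2 ^ L"
    using annihilation_carrier by auto
  have cdims: "dim_row (creation L j) = 2 ^ L" "dim_col (creation L j) = 2 ^ L"
    by (simp_all add: creation_def mat_adjoint_def dims)
  have inj: "s = t" if "bit s ?n" "bit t ?n" "unset_bit ?n s = unset_bit ?n t"
  proof (rule bit_eqI)
    show "bit s m \<longleftrightarrow> bit t m" for m
      using that(1,2) arg_cong[OF that(3), of "\<lambda>x. bit x m"]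
      by (cases "m = ?n") (auto simp: bit_unset_bit_iff)
  qed
  have lt: "unset_bit ?n t < 2 ^ L"
  proof -
    have "unset_bit ?n t \<le> t"
      using unset_bit_less_eq[of ?n "int t"]
      unfolding of_nat_unset_bit_eq[where 'a = int, symmetric] of_nat_le_iff .
    then show ?thesis
      using assms(2) by (rule le_less_trans)
  qed
  have sq: "cnj (?sg t) * ?sg t = 1"
    by (simp flip: power_mult_distrib)
  have "(creation L j * annihilation L j) $$ (s, t) =
      (\<Sum>r<2 ^ L. creation L j $$ (s, r) * annihilation L j $$ (r, t))"
    using assms by (simp add: dims cdims scalar_prod_def atLeast0LessThan)
  also have "\<dots> = (\<Sum>r<2 ^ L. if r = unset_bit ?n t then
      (if s = t \<and> bit s ?n then 1 else 0) else 0)"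
  proof (rule sum.cong[OF refl])
    fix r :: nat assume "r \<in> {..<2 ^ L}"
    then have r: "r < 2 ^ L" by simp
    have ann: "annihilation L j $$ (r, t) = (if bit t ?n \<and> r = unset_bit ?n t then ?sg t else 0)"
      "annihilation L j $$ (r, s) = (if bit s ?n \<and> r = unset_bit ?n s then ?sg s else 0)"
      unfolding annihilation_def index_mat(1)[OF r assms(1)] index_mat(1)[OF r assms(2)] prod.case
      by (rule refl)+
    have cre: "creation L j $$ (s, r) = cnj (annihilation L j $$ (r, s))"
      unfolding creation_def using assms r by (subst mat_adjoint_index) (simp_all add: dims)
    show "creation L j $$ (s, r) * annihilation L j $$ (r, t) =
      (if r = unset_bit ?n t then (if s = t \<and> bit s ?n then 1 else 0) else 0)"
    proof (cases "bit s ?n \<and> bit t ?n \<and> r = unset_bit ?n s \<and> r = unset_bit ?n t")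
      case True
      then have "s = t" using inj by blast
      with True sq show ?thesis unfolding cre ann by presburger
    next
      case False
      then consider "\<not> (bit t ?n \<and> r = unset_bit ?n t)" | "\<not> (bit s ?n \<and> r = unset_bit ?n s)"
        by blast
      then have "creation L j $$ (s, r) * annihilation L j $$ (r, t) = 0"
      proof cases
        case 1
        show ?thesis unfolding cre ann(1) if_not_P[OF 1] by (rule mult_zero_right)
      next
        case 2
        show ?thesis unfolding cre ann(2) if_not_P[OF 2] complex_cnj_zero by (rule mult_zero_left)
      qed
      moreover have "\<not> (r = unset_bit ?n t \<and> s = t \<and> bit s ?n)"
        using False by blast
      ultimately show ?thesis by (simp only: if_splits) blast
    qed
  qed
  also have "\<dots> = (if s = t \<and> bit s ?n then 1 else 0)"
    using lt by simp
  finally show ?thesis .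
qed

lemma extend_block_number:
  assumes "a + l \<le> L"
  shows "extend_from_block L a l (block_number l) = particle_number L {a + 1..a + l}"
proof (rule eq_matI)
  fix s t :: nat
  assume "s < dim_row (particle_number L {a + 1..a + l})"
    and "t < dim_col (particle_number L {a + 1..a + l})"
  then have st: "s < 2 ^ L" "t < 2 ^ L"
    by (auto simp: particle_number_def mat_sum_def)
  have num: "particle_number M S $$ (x, y) =
      (\<Sum>j\<in>S. if x = y \<and> bit x (j - 1) then 1 else 0)" if "x < 2 ^ M" "y < 2 ^ M" for M S x y
    using that by (simp add: particle_number_def mat_sum_def number_index)
  have split: "s = t" if "s mod 2 ^ a = t mod 2 ^ a" "s div 2 ^ (a + l) = t div 2 ^ (a + l)"
      "s div 2 ^ a mod 2 ^ l = t div 2 ^ a mod 2 ^ l"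
    using that by (metis div_mult_mod_eq div_mult2_eq power_add)
  have bits: "(\<Sum>j=1..l. if bit (s div 2 ^ a mod 2 ^ l) (j - 1) then 1 else 0) =
      (\<Sum>j=a + 1..a + l. if bit s (j - 1) then 1 else (0 :: complex))"
  proof -
    have "(\<Sum>j=a + 1..a + l. if bit s (j - 1) then 1 else (0 :: complex)) =
        (\<Sum>j=1..l. if bit s (j + a - 1) then 1 else 0)"
      using sum.shift_bounds_cl_nat_ivl[of "\<lambda>j. if bit s (j - 1) then 1 else (0 :: complex)" 1 a l]
      by (simp add: add.commute)
    also have "\<dots> = (\<Sum>j=1..l. if bit (s div 2 ^ a mod 2 ^ l) (j - 1) then 1 else 0)"
      by (intro sum.cong refl)
        (auto simp: bit_take_bit_iff bit_drop_bit_eq add.commute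
              simp flip: take_bit_eq_mod drop_bit_eq_div)
    finally show ?thesis by simp
  qed
  show "extend_from_block L a l (block_number l) $$ (s, t) =
      particle_number L {a + 1..a + l} $$ (s, t)"
  proof (cases "s = t")
    case True
    then show ?thesis
      using st bits by (simp add: extend_from_block_def block_number_def num)
  next
    case False
    then have "particle_number L {a + 1..a + l} $$ (s, t) = 0"
      using st by (simp add: num)
    moreover have "extend_from_block L a l (block_number l) $$ (s, t) = 0"
    proof (cases "s div 2 ^ a mod 2 ^ l = t div 2 ^ a mod 2 ^ l")
      case True
      then have "\<not> (s mod 2 ^ a = t mod 2 ^ a \<and> s div 2 ^ (a + l) = t div 2 ^ (a + l))"
        using split False by blast
      then show ?thesis
        using st by (simp only: extend_from_block_def index_mat(1) prod.case if_False)
    next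
      case False
      then show ?thesis
        using st by (simp add: extend_from_block_def block_number_def num)
    qed
    ultimately show ?thesis by simp
  qed
qed (simp_all add: extend_from_block_def particle_number_def mat_sum_def)

end

theory Submission
  imports Defs
begin

text \<open>
  A Slater determinant of \<open>N\<close> modes is supported on configurations with exactly \<open>N\<close> occupied
  sites. In the partial trace both indices are completed by the same configuration outside the
  block, so a nonzero entry of \<open>\<rho>\<^sub>A\<close> connects two block configurations with equally many
  particles. Hence \<open>\<rho>\<^sub>A\<close> is block diagonal for \<open>Q\<^sub>A\<close>, which is diagonal in this basis, and the
  dephasing map fixes it.
\<close>

section \<open>Diagonal matrices\<close>

definition diagonal_fun_mat :: "nat \<Rightarrow> (nat \<Rightarrow> complex) \<Rightarrow> complex mat" where
  "diagonal_fun_mat d c = mat d d (\<lambda>(i, k). if i = k then c i else 0)"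

lemma diagonal_fun_mat_carrier [simp]: "diagonal_fun_mat d c \<in> carrier_mat d d"
  by (simp add: diagonal_fun_mat_def)

lemma diagonal_fun_mat_dim [simp]:
  "dim_row (diagonal_fun_mat d c) = d" "dim_col (diagonal_fun_mat d c) = d"
  by (simp_all add: diagonal_fun_mat_def)

lemma diagonal_fun_mat_index [simp]:
  "i < d \<Longrightarrow> k < d \<Longrightarrow> diagonal_fun_mat d c $$ (i, k) = (if i = k then c i else 0)"
  by (simp add: diagonal_fun_mat_def)

lemma diagonal_mult_vec_index:
  assumes "v \<in> carrier_vec d" "i < d"
  shows "(diagonal_fun_mat d c *\<^sub>v v) $ i = c i * v $ i"
proof -
  have "(diagonal_fun_mat d c *\<^sub>v v) $ i = (\<Sum>k<d. (if i = k then c i else 0) * v $ k)"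
    using assms by (auto simp: scalar_prod_def atLeast0LessThan intro!: sum.cong)
  also have "\<dots> = (\<Sum>k<d. if i = k then c i * v $ i else 0)"
    by (intro sum.cong) auto
  finally show ?thesis
    using assms by simp
qed

lemma diagonal_mult_index:
  assumes "M \<in> carrier_mat d n" "i < d" "k < n"
  shows "(diagonal_fun_mat d c * M) $$ (i, k) = c i * M $$ (i, k)"
proof -
  have "(diagonal_fun_mat d c * M) $$ (i, k) = (diagonal_fun_mat d c *\<^sub>v col M k) $ i"
    using assms by simp
  then show ?thesis
    using assms diagonal_mult_vec_index[of "col M k" d i c] by simp
qed

lemma mult_diagonal_index:
  assumes "M \<in> carrier_mat n d" "i < n" "k < d"
  shows "(M * diagonal_fun_mat d c) $$ (i, k) = M $$ (i, k) * c k"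
proof -
  have "(M * diagonal_fun_mat d c) $$ (i, k) = (\<Sum>j<d. M $$ (i, j) * (if j = k then c j else 0))"
    using assms by (auto simp: scalar_prod_def atLeast0LessThan intro!: sum.cong)
  also have "\<dots> = (\<Sum>j<d. if j = k then M $$ (i, k) * c k else 0)"
    by (intro sum.cong) auto
  finally show ?thesis
    using assms by simp
qed

text \<open>Each coordinate equation factors over the field. It serves twice: for the eigenvectors
  of the diagonal matrix, and with \<open>q = 1\<close> for the vectors fixed by a diagonal
  projection.\<close>

lemma diagonal_mult_vec_eq_smult_iff:
  assumes "v \<in> carrier_vec d"
  shows "diagonal_fun_mat d c *\<^sub>v v = q \<cdot>\<^sub>v v \<longleftrightarrow> (\<forall>i<d. c i = q \<or> v $ i = 0)"
proof -
  have "diagonal_fun_mat d c *\<^sub>v v = q \<cdot>\<^sub>v v \<longleftrightarrow> (\<forall>i<d. c i * v $ i = q * v $ i)"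
    using assms by (auto simp: vec_eq_iff diagonal_mult_vec_index simp del: index_mult_mat_vec)
  then show ?thesis
    by (simp add: disj_commute)
qed

text \<open>The unit vector at \<open>i\<close> is an eigenvector. This ensures that the sum
  defining \<open>dephasing\<close> really contains the term for \<open>c i\<close>.\<close>

lemma spectrum_diagonal:
  assumes "i < d"
  shows "c i \<in> spectrum (diagonal_fun_mat d c)"
proof -
  have "eigenvector (diagonal_fun_mat d c) (unit_vec d i) (c i)"
    using assms by (simp add: eigenvector_def diagonal_mult_vec_eq_smult_iff unit_vec_nonzero)
  then show ?thesis
    by (auto simp: spectrum_def eigenvalue_def)
qed

lemma mat_adjoint_dim [simp]:
  "dim_row (mat_adjoint M) = dim_col M" "dim_col (mat_adjoint M) = dim_row M"
  by (simp_all add: mat_adjoint_def)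

text \<open>Evaluates the definite description: the 0/1 indicator matrix has the required
  properties, and any other candidate agrees with it column by column. If no \<open>c i\<close>
  equals \<open>q\<close>, both sides are zero.\<close>

lemma eigenprojection_diagonal:
  "eigenprojection (diagonal_fun_mat d c) q = diagonal_fun_mat d (\<lambda>i. if c i = q then 1 else 0)"
  (is "_ = ?E")
  unfolding eigenprojection_def
proof (rule the_equality)
  have E_fix: "?E *\<^sub>v v = v \<longleftrightarrow> (\<forall>i<d. c i = q \<or> v $ i = 0)" if "v \<in> carrier_vec d" for v
    using diagonal_mult_vec_eq_smult_iff[OF that, of "\<lambda>i. if c i = q then 1 else 0" 1] by auto
  show "?E \<in> carrier_mat (dim_row (diagonal_fun_mat d c)) (dim_row (diagonal_fun_mat d c)) \<and>
      mat_adjoint ?E = ?E \<and> ?E * ?E = ?E \<and>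
      (\<forall>v\<in>carrier_vec (dim_row (diagonal_fun_mat d c)).
         ?E *\<^sub>v v = v \<longleftrightarrow> diagonal_fun_mat d c *\<^sub>v v = q \<cdot>\<^sub>v v)"
  proof (intro conjI ballI)
    show "mat_adjoint ?E = ?E"
      by (rule eq_matI) (auto simp: mat_adjoint_index)
    show "?E * ?E = ?E"
      by (rule eq_matI)
        (auto simp: diagonal_mult_index[OF diagonal_fun_mat_carrier] simp del: index_mult_mat(1))
  qed (simp_all add: E_fix diagonal_mult_vec_eq_smult_iff)
  fix P :: "complex mat"
  assume "P \<in> carrier_mat (dim_row (diagonal_fun_mat d c)) (dim_row (diagonal_fun_mat d c)) \<and>
      mat_adjoint P = P \<and> P * P = P \<and>
      (\<forall>v\<in>carrier_vec (dim_row (diagonal_fun_mat d c)).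
         P *\<^sub>v v = v \<longleftrightarrow> diagonal_fun_mat d c *\<^sub>v v = q \<cdot>\<^sub>v v)"
  then have P: "P \<in> carrier_mat d d" and adj: "mat_adjoint P = P" and idem: "P * P = P"
    and fixed: "\<And>v. v \<in> carrier_vec d \<Longrightarrow> P *\<^sub>v v = v \<longleftrightarrow> (\<forall>i<d. c i = q \<or> v $ i = 0)"
    by (simp_all add: diagonal_mult_vec_eq_smult_iff)
  have herm: "P $$ (i, k) = cnj (P $$ (k, i))" if "i < d" "k < d" for i k
    using mat_adjoint_index[of i P k] P adj that by simp
  \<comment> \<open>By idempotence every column of \<open>P\<close> is a fixed vector of
    \<open>P\<close>, hence supported where \<open>c\<close> takes the value
    \<open>q\<close>.\<close>
  have rows: "P $$ (i, k) = 0" if "i < d" "k < d" "c i \<noteq> q" for i k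
  proof -
    have "P *\<^sub>v col P k = col P k"
      using col_mult2[OF P P that(2)] idem by simp
    then show ?thesis
      using fixed[of "col P k"] P that by auto
  qed
  have "P $$ (i, k) = ?E $$ (i, k)" if ik: "i < d" "k < d" for i k
  proof (cases "c k = q")
    case True
    then have "P *\<^sub>v unit_vec d k = unit_vec d k"
      using ik by (simp add: fixed)
    moreover have "P *\<^sub>v unit_vec d k = col P k"
      using P ik by (intro eq_vecI) auto
    ultimately have "col P k = unit_vec d k"
      by simp
    then have "col P k $ i = unit_vec d k $ i"
      by simp
    then show ?thesis
      using P ik True by auto
  next
    case False
    \<comment> \<open>Column \<open>k\<close> is the conjugate of row \<open>k\<close>, which
      vanishes by \<open>rows\<close>.\<close>
    then show ?thesis
      using rows[OF ik(2,1)] herm[OF ik] ik by auto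
  qed
  with P show "P = ?E"
    by (intro eq_matI) auto
qed

text \<open>The term for \<open>q\<close> multiplies the entry at \<open>(i, k)\<close> by the
  indicators of \<open>c i = q\<close> and \<open>c k = q\<close>. For a nonzero entry the two
  conditions coincide, so exactly the term \<open>q = c i\<close> contributes.\<close>

lemma dephasing_diagonal_eq_self:
  assumes R: "R \<in> carrier_mat d d"
    and blocks: "\<And>i k. i < d \<Longrightarrow> k < d \<Longrightarrow> R $$ (i, k) \<noteq> 0 \<Longrightarrow> c i = c k"
  shows "dephasing (diagonal_fun_mat d c) R = R"
proof (rule eq_matI)
  fix i k assume "i < dim_row R" "k < dim_col R"
  with R have ik: "i < d" "k < d"
    by auto
  let ?Q = "diagonal_fun_mat d c"
  let ?E = "\<lambda>q. diagonal_fun_mat d (\<lambda>i. if c i = q then 1 else 0)"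
  \<comment> \<open>A sum over an infinite set would be 0 by convention, so finiteness is needed to
    extract the surviving term.\<close>
  have fin: "finite (spectrum ?Q)"
    using card_finite_spectrum(1)[OF diagonal_fun_mat_carrier] .
  have "dephasing ?Q R $$ (i, k) = (\<Sum>q\<in>spectrum ?Q. (?E q * R * ?E q) $$ (i, k))"
    using R ik by (simp add: dephasing_def mat_sum_def eigenprojection_diagonal del: index_mult_mat(1))
  also have "\<dots> = (\<Sum>q\<in>spectrum ?Q. if q = c i then R $$ (i, k) else 0)"
  proof (rule sum.cong[OF refl])
    fix q
    have "(?E q * R * ?E q) $$ (i, k) =
        (if c i = q then 1 else 0) * R $$ (i, k) * (if c k = q then 1 else 0)"
      unfolding mult_diagonal_index[OF mult_carrier_mat[OF diagonal_fun_mat_carrier R] ik]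
        diagonal_mult_index[OF R ik] by (rule refl)
    then show "(?E q * R * ?E q) $$ (i, k) = (if q = c i then R $$ (i, k) else 0)"
      using blocks[OF ik] by (cases "R $$ (i, k) = 0") auto
  qed
  also have "\<dots> = R $$ (i, k)"
    using fin spectrum_diagonal[OF ik(1)] by simp
  finally show "dephasing ?Q R $$ (i, k) = R $$ (i, k)" .
qed (use R in \<open>simp_all add: dephasing_def mat_sum_def\<close>)

text \<open>The two products scale the entry at \<open>(i, k)\<close> by \<open>c k\<close> and by
  \<open>c i\<close> respectively, and these agree wherever the entry is nonzero.\<close>

lemma commute_diagonal:
  assumes R: "R \<in> carrier_mat d d"
    and blocks: "\<And>i k. i < d \<Longrightarrow> k < d \<Longrightarrow> R $$ (i, k) \<noteq> 0 \<Longrightarrow> c i = c k"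
  shows "R * diagonal_fun_mat d c = diagonal_fun_mat d c * R"
proof (rule eq_matI)
  fix i k assume "i < dim_row (diagonal_fun_mat d c * R)" "k < dim_col (diagonal_fun_mat d c * R)"
  with R have ik: "i < d" "k < d"
    by auto
  show "(R * diagonal_fun_mat d c) $$ (i, k) = (diagonal_fun_mat d c * R) $$ (i, k)"
    unfolding mult_diagonal_index[OF R ik] diagonal_mult_index[OF R ik]
    using blocks[OF ik] by (cases "R $$ (i, k) = 0") auto
qed (use R in auto)

section \<open>Particle numbers\<close>

text \<open>For a basis index this is the number of occupied sites, that is, the eigenvalue of the
  total particle number.\<close>

definition popcount :: "nat \<Rightarrow> nat" where
  "popcount s = card {i. bit s i}"

lemma bit_nat_imp_less:
  fixes s :: nat
  assumes "bit s i" "s < 2 ^ n"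
  shows "i < n"
  using assms by (metis bit_take_bit_iff take_bit_nat_eq_self)

lemma finite_bits: "finite {i. bit (s :: nat) i}"
  \<comment> \<open>The bound comes from \<open>bit_nat_imp_less\<close> with \<open>n = s\<close>,
    since \<open>s < 2 ^ s\<close>.\<close>
  by (rule finite_subset[of _ "{..<s}"]) (auto intro: bit_nat_imp_less)

lemma popcount_0: "popcount 0 = 0"
  by (simp add: popcount_def)

text \<open>The bits of \<open>x\<close> stay below position \<open>a\<close> and those of
  \<open>r\<close> are shifted up by \<open>a\<close>, so the two sets are disjoint. Applied twice,
  this splits the particle count of a chain configuration into left, block and right parts.\<close>

lemma popcount_add_shift:
  assumes "x < 2 ^ a"
  shows "popcount (x + 2 ^ a * r) = popcount x + popcount r"
proof -
  let ?s = "x + 2 ^ a * r"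
  have low: "bit ?s i = bit x i" if "i < a" for i
  proof -
    have "take_bit a ?s = x"
      using assms by (simp add: take_bit_eq_mod)
    then show ?thesis
      using that by (metis bit_take_bit_iff)
  qed
  have high: "bit ?s (a + i) = bit r i" for i
  proof -
    have "drop_bit a ?s = r"
      using assms by (simp add: drop_bit_eq_div)
    then show ?thesis
      by (metis bit_drop_bit_eq comp_apply)
  qed
  have "{i. bit ?s i} = {i. bit x i} \<union> (+) a ` {i. bit r i}"
  proof (rule Set.set_eqI)
    fix i
    show "i \<in> {i. bit ?s i} \<longleftrightarrow> i \<in> {i. bit x i} \<union> (+) a ` {i. bit r i}"
    proof (cases "i < a")
      case True
      then show ?thesis by (auto simp: low)
    next
      case False
      then have "i = a + (i - a)" by simp
      with False assms show ?thesis
        using high[of "i - a"] bit_nat_imp_less[of x i a] by (auto simp: high)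
    qed
  qed
  moreover have "{i. bit x i} \<inter> (+) a ` {i. bit r i} = {}"
    using assms by (auto dest!: bit_nat_imp_less)
  ultimately show ?thesis
    by (simp add: popcount_def card_Un_disjoint finite_bits card_image)
qed

lemma popcount_unset_bit:
  assumes "bit s n"
  shows "popcount s = Suc (popcount (unset_bit n s))"
proof -
  have "{i. bit s i} = insert n {i. bit (unset_bit n s) i}"
    using assms by (auto simp: bit_unset_bit_iff)
  moreover have "n \<notin> {i. bit (unset_bit n s) i}"
    by (simp add: bit_unset_bit_iff)
  ultimately show ?thesis
    by (simp add: popcount_def finite_bits)
qed

text \<open>Occupation-number basis vectors are eigenvectors of the particle number, which makes the
  results on diagonal matrices applicable to \<open>Q\<close>.\<close>

lemma block_number_diagonal:
  "block_number l = diagonal_fun_mat (2 ^ l) (\<lambda>i. of_nat (popcount i))"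
proof (rule eq_matI)
  fix i k assume "i < dim_row (diagonal_fun_mat (2 ^ l) (\<lambda>i. of_nat (popcount i)))"
    and "k < dim_col (diagonal_fun_mat (2 ^ l) (\<lambda>i. of_nat (popcount i)))"
  then have ik: "i < 2 ^ l" "k < 2 ^ l"
    by simp_all
  have "block_number l $$ (i, k) = (\<Sum>j=1..l. if i = k \<and> bit i (j - 1) then 1 else 0)"
    using ik by (simp add: block_number_def particle_number_def mat_sum_def number_index)
  also have "\<dots> = (if i = k then of_nat (popcount i) else 0)"
  proof (cases "i = k")
    case True
    \<comment> \<open>Sites are numbered from 1 but bits from 0, hence the shift by
      \<open>Suc\<close>.\<close>
    have "{j \<in> {1..l}. bit i (j - 1)} = Suc ` {j. bit i j}"
    proof (rule Set.set_eqI)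
      fix j
      show "j \<in> {j \<in> {1..l}. bit i (j - 1)} \<longleftrightarrow> j \<in> Suc ` {j. bit i j}"
        using bit_nat_imp_less[OF _ ik(1)] by (cases j) fastforce+
    qed
    then have "card {j \<in> {1..l}. bit i (j - 1)} = popcount i"
      by (simp add: popcount_def card_image)
    then show ?thesis
      using True by (simp flip: sum.inter_filter)
  qed simp
  finally show "block_number l $$ (i, k) = diagonal_fun_mat (2 ^ l) (\<lambda>i. of_nat (popcount i)) $$ (i, k)"
    using ik by simp
qed (simp_all add: block_number_def particle_number_def mat_sum_def)

section \<open>Support of Slater determinants\<close>

lemma creation_nonzero_popcount:
  assumes "s < 2 ^ L" "t < 2 ^ L" "creation L j $$ (s, t) \<noteq> 0"
  shows "popcount s = Suc (popcount t)"
proof -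
  \<comment> \<open>Passing to the adjoint swaps the indices, so \<open>t\<close> is
    \<open>s\<close> with one occupied site emptied. The Jordan-Wigner sign does not affect the
    support.\<close>
  have "annihilation L j $$ (t, s) \<noteq> 0"
    using assms annihilation_carrier[of L j] by (auto simp: creation_def mat_adjoint_index)
  then have "bit s (j - 1) \<and> t = unset_bit (j - 1) s"
    using assms(1,2) unfolding annihilation_def by (simp only: index_mat prod.case split: if_splits)
  then show ?thesis
    using popcount_unset_bit by blast
qed

lemma mode_creation_nonzero_popcount:
  assumes "s < 2 ^ L" "t < 2 ^ L" "mode_creation L u $$ (s, t) \<noteq> 0"
  shows "popcount s = Suc (popcount t)"
proof -
  have cr: "creation L j \<in> carrier_mat (2 ^ L) (2 ^ L)" for j
    using annihilation_carrier[of L j] by (auto simp: creation_def)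
  have dims: "dim_row (creation L j) = 2 ^ L" "dim_col (creation L j) = 2 ^ L" for j
    using cr[of j] by auto
  have "(\<Sum>j=1..L. u j * creation L j $$ (s, t)) \<noteq> 0"
    using assms by (simp add: mode_creation_def mat_sum_def dims)
  then obtain j where "u j * creation L j $$ (s, t) \<noteq> 0"
    by (rule sum.not_neutral_contains_not_neutral)
  then have "creation L j $$ (s, t) \<noteq> 0"
    by simp
  then show ?thesis
    using creation_nonzero_popcount assms by blast
qed

lemma dim_slater: "dim_vec (slater L u n) = 2 ^ L"
  by (cases n) (simp_all add: vacuum_def mode_creation_def mat_sum_def)

text \<open>Induction on the number of filled modes: the vacuum lives on the empty configuration
  \<open>0\<close>, and every mode creation operator raises the count by one.\<close>

lemma slater_nonzero_popcount:
  assumes "s < 2 ^ L" "slater L u n $ s \<noteq> 0"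
  shows "popcount s = n"
  using assms
proof (induction n arbitrary: s)
  case 0
  then show ?case
    by (cases "s = 0") (simp_all add: vacuum_def popcount_0)
next
  case (Suc n)
  have "(\<Sum>t<2 ^ L. mode_creation L (u (Suc n)) $$ (s, t) * slater L u n $ t) \<noteq> 0"
    using Suc.prems
    by (simp add: scalar_prod_def dim_slater atLeast0LessThan)
      (simp add: mode_creation_def mat_sum_def scalar_prod_def dim_slater atLeast0LessThan)
  then obtain t where "t \<in> {..<2 ^ L}"
    and "mode_creation L (u (Suc n)) $$ (s, t) * slater L u n $ t \<noteq> 0"
    by (rule sum.not_neutral_contains_not_neutral)
  then have "t < 2 ^ L" "mode_creation L (u (Suc n)) $$ (s, t) \<noteq> 0" "slater L u n $ t \<noteq> 0"
    by simp_all
  then show ?case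
    using Suc.IH[of t] mode_creation_nonzero_popcount[OF Suc.prems(1)] by simp
qed

section \<open>Partial trace over the complement of the block\<close>

lemma block_index_less:
  assumes "a + l \<le> L" "x < 2 ^ a" "i < 2 ^ l" "y < 2 ^ (L - a - l)"
  shows "x + 2 ^ a * (i + 2 ^ l * y) < (2 :: nat) ^ L"
proof -
  \<comment> \<open>The bound for a two-digit number with lower digit in base \<open>m\<close>;
    nesting it handles the three digits \<open>x\<close>, \<open>i\<close>,
    \<open>y\<close>.\<close>
  have step: "x + m * i < m * k" if "x < m" "i < k" for x i m k :: nat
  proof -
    have "x + m * i < m * Suc i"
      using that by simp
    also have "\<dots> \<le> m * k"
      using that by (intro mult_le_mono2) simp
    finally show ?thesis .
  qed
  have "(2 :: nat) ^ L = 2 ^ a * (2 ^ l * 2 ^ (L - a - l))"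
    using assms(1) by (simp flip: power_add)
  then show ?thesis
    using step[OF assms(2) step[OF assms(3,4)]] by simp
qed

lemma reduced_ground_state_nonzero_popcount:
  assumes gs: "is_ground_state L N \<psi>" and al: "a + l \<le> L" and ik: "i < 2 ^ l" "k < 2 ^ l"
    and nz: "reduced_to_block L a l (pure_density \<psi>) $$ (i, k) \<noteq> 0"
  shows "popcount i = popcount k"
proof -
  obtain u z where \<psi>: "\<psi> = z \<cdot>\<^sub>v slater L u N"
    using gs unfolding is_ground_state_def by blast
  let ?c = "\<lambda>x i y. x + 2 ^ a * (i + 2 ^ l * y)"
  have dim: "dim_vec \<psi> = 2 ^ L"
    by (simp add: \<psi> dim_slater)
  have supp: "popcount s = N" if "s < 2 ^ L" "\<psi> $ s \<noteq> 0" for s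
    using that by (auto simp: \<psi> dim_slater intro: slater_nonzero_popcount)
  have "(\<Sum>x<2 ^ a. \<Sum>y<2 ^ (L - a - l). pure_density \<psi> $$ (?c x i y, ?c x k y)) \<noteq> 0"
    using nz ik by (simp add: reduced_to_block_def)
  then obtain x y where xy: "x < 2 ^ a" "y < 2 ^ (L - a - l)"
    and ent: "pure_density \<psi> $$ (?c x i y, ?c x k y) \<noteq> 0"
    by (meson lessThan_iff sum.neutral)
  have lt: "?c x i y < 2 ^ L" "?c x k y < 2 ^ L"
    using block_index_less al xy ik by blast+
  \<comment> \<open>An entry of the pure density is a product of one amplitude and one conjugate
    amplitude, so neither vanishes and both configurations carry \<open>N\<close> particles.\<close>
  have "\<psi> $ ?c x i y \<noteq> 0" "\<psi> $ ?c x k y \<noteq> 0"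
    using ent lt by (auto simp: pure_density_def dim)
  then have "popcount (?c x i y) = popcount (?c x k y)"
    using supp lt by metis
  \<comment> \<open>The environment contributes \<open>popcount x + popcount y\<close> to both
    counts and cancels.\<close>
  then show ?thesis
    using xy ik by (simp add: popcount_add_shift)
qed

theorem mainTheorem2:
  fixes L N a l :: nat and \<psi> :: "complex vec" and \<rho> Q :: "complex mat"
  assumes "1 \<le> L" and "N \<le> L"
    and "is_ground_state L N \<psi>"
    and "a + l \<le> L"
    and "\<rho> = reduced_to_block L a l (pure_density \<psi>)"
    and "Q = block_number l"
  shows "\<rho> * Q - Q * \<rho> = 0\<^sub>m (2 ^ l) (2 ^ l) \<and>
    (\<forall>\<alpha>>0. renyi_asymmetry \<alpha> Q \<rho> = 0)"
proof -
  have \<rho>: "\<rho> \<in> carrier_mat (2 ^ l) (2 ^ l)"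
    by (simp add: assms(5) reduced_to_block_def)
  \<comment> \<open>The counts are cast to complex numbers because they act as the diagonal entries
    of \<open>Q\<close>.\<close>
  have blocks: "of_nat (popcount i) = (of_nat (popcount k) :: complex)"
    if "i < 2 ^ l" "k < 2 ^ l" "\<rho> $$ (i, k) \<noteq> 0" for i k
    using reduced_ground_state_nonzero_popcount[OF assms(3,4) that(1,2) that(3)[unfolded assms(5)]]
    by (rule arg_cong)
  have "\<rho> * Q = Q * \<rho>"
    unfolding assms(6) block_number_diagonal using \<rho> blocks by (rule commute_diagonal)
  moreover have "Q * \<rho> - Q * \<rho> = 0\<^sub>m (2 ^ l) (2 ^ l)"
    unfolding assms(6) block_number_diagonal
    by (rule minus_r_inv_mat[OF mult_carrier_mat[OF diagonal_fun_mat_carrier \<rho>]])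
  \<comment> \<open>Both entropies are then taken of the same matrix, so their difference vanishes
    for every \<alpha>, including the von Neumann case, with no entropy evaluated.\<close>
  moreover have "dephasing Q \<rho> = \<rho>"
    unfolding assms(6) block_number_diagonal using \<rho> blocks by (rule dephasing_diagonal_eq_self)
  ultimately show ?thesis
    by (simp add: renyi_asymmetry_def)
qed

end
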